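(* Let $(f_t)_{t\ge0}$ be a normal Loewner chain in $\mathbb{B}^2$. Then the family of shearings $(f_t^{[c]})_{t\ge 0}$ is a normal Loewner chain in $\mathbb{B}^2$. In particular, if $f\in S^0(\mathbb{B}^2)$ then $f^{[c]}\in S^0(\mathbb{B}^2)$.
   Context: $\mathbb{B}^2=\{z\in\mathbb{C}^2:\|z\|<1\}$ is the Euclidean unit ball. Univalent means holomorphic and injective. A normalized Loewner chain on $\mathbb{B}^2$ is a family $(f_t)_{t\ge 0}$ of univalent maps $f_t:\mathbb{B}^2\to\mathbb{C}^2$ such that $f_s(\mathbb{B}^2)\subset f_t(\mathbb{B}^2)$ for $0\le s\le t$, $f_t(0)=0$ and $d(f_t)_0=e^t\,\mathrm{id}$ for all $t\ge 0$. It is a normal Loewner chain if moreover $\{e^{-t}f_t\}_{t\ge0}$ is a normal family in $\mathbb{B}^2$. $S^0(\mathbb{B}^2)$ is the set of univalent maps $f:\mathbb{B}^2\to\mathbb{C}^2$ with $f(0)=0$, $df_0=\mathrm{id}$, for which there exists a normal Loewner chain $(f_t)$ with $f_0=f$. Shearing: let $h:\mathbb{B}^2\to\mathbb{C}^2$ be holomorphic with $h(0)=0$ and $dh_0$ diagonal and invertible. Write its Taylor expansion at $0$ as $h(z)=(\lambda z_1+Az_2^2+O(|z_1|^2,|z_1z_2|,\|z\|^3),\ \mu z_2+O(\|z\|^2))$, i.e. $dh_0=\mathrm{diag}(\lambda,\mu)$ and $A=\frac12\frac{\partial^2h_1}{\partial z_2^2}(0)$. The shearing of $h$ is the map $h^{[c]}(z_1,z_2):=(\lambda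 z_1+Az_2^2,\ \mu z_2)$, $z\in\mathbb{B}^2$. *)

theory Defs
  imports "HOL-Analysis.Analysis"
begin

text \<open>
  \<open>\<complex>\<^sup>n\<close> is \<^typ>\<open>complex^'n\<close>, whose norm is the Euclidean one. Maps on the unit ball are
  represented by total functions; only their values on \<open>ball 0 1\<close> matter in what follows.
\<close>

text \<open>Complex differentiability is a Frechet derivative given by a complex matrix.\<close>

definition holomorphic_map_on :: "(complex^'n \<Rightarrow> complex^'m) \<Rightarrow> (complex^'n) set \<Rightarrow> bool" where
  "holomorphic_map_on f S \<longleftrightarrow>
     (\<forall>z\<in>S. \<exists>L::complex^'n^'m. (f has_derivative (\<lambda>v. L *v v)) (at z))"

definition univalent_on :: "(complex^'n \<Rightarrow> complex^'m) \<Rightarrow> (complex^'n) set \<Rightarrow> bool" where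
  "univalent_on f S \<longleftrightarrow> holomorphic_map_on f S \<and> inj_on f S"

text \<open>
  Normality in the sense of Montel: locally uniform convergence of subsequences. The variant that
  also admits compactly divergent subsequences agrees with this one for families of maps fixing the
  origin, the only ones considered here.
\<close>

definition normal_family_on :: "(complex^'n \<Rightarrow> complex^'m) set \<Rightarrow> (complex^'n) set \<Rightarrow> bool" where
  "normal_family_on F S \<longleftrightarrow>
     (\<forall>\<phi>::nat \<Rightarrow> complex^'n \<Rightarrow> complex^'m. (\<forall>k. \<phi> k \<in> F) \<longrightarrow>
        (\<exists>r g. strict_mono (r::nat \<Rightarrow> nat) \<and>
           (\<forall>K. compact K \<and> K \<subseteq> S \<longrightarrow> uniform_limit K (\<phi> \<circ> r) g sequentially)))"

definition normalized_Loewner_chain :: "(real \<Rightarrow> complex^2 \<Rightarrow> complex^2) \<Rightarrow> bool" where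
  "normalized_Loewner_chain f \<longleftrightarrow>
     (\<forall>t\<ge>0. univalent_on (f t) (ball 0 1)) \<and>
     (\<forall>s t. 0 \<le> s \<and> s \<le> t \<longrightarrow> f s ` ball 0 1 \<subseteq> f t ` ball 0 1) \<and>
     (\<forall>t\<ge>0. f t 0 = 0 \<and> (f t has_derivative (\<lambda>v. exp t *\<^sub>R v)) (at 0))"

definition normal_Loewner_chain :: "(real \<Rightarrow> complex^2 \<Rightarrow> complex^2) \<Rightarrow> bool" where
  "normal_Loewner_chain f \<longleftrightarrow>
     normalized_Loewner_chain f \<and>
     normal_family_on {\<lambda>z. exp (- t) *\<^sub>R f t z |t. t \<ge> 0} (ball 0 1)"

definition S0 :: "(complex^2 \<Rightarrow> complex^2) set" where
  "S0 = {f. univalent_on f (ball 0 1) \<and> f 0 = 0 \<and> (f has_derivative (\<lambda>v. v)) (at 0) \<and>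
            (\<exists>F. normal_Loewner_chain F \<and> (\<forall>z\<in>ball 0 1. F 0 z = f z))}"

definition partial_deriv :: "'n \<Rightarrow> (complex^'n \<Rightarrow> complex) \<Rightarrow> complex^'n \<Rightarrow> complex" where
  "partial_deriv j g a = deriv (\<lambda>\<zeta>. g (a + axis j \<zeta>)) 0"

text \<open>
  The first two coefficients are the diagonal entries of the differential at the origin. The
  definition is meant for holomorphic \<open>h\<close> with \<open>h 0 = 0\<close> and diagonal invertible differential at
  the origin, which every member of a normalized Loewner chain satisfies.
\<close>

definition shearing :: "(complex^2 \<Rightarrow> complex^2) \<Rightarrow> complex^2 \<Rightarrow> complex^2" where
  "shearing h = (\<lambda>z.
     let l = partial_deriv 1 (\<lambda>w. h w $ 1) 0;
         m = partial_deriv 2 (\<lambda>w. h w $ 2) 0;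
         A = 1/2 * partial_deriv 2 (partial_deriv 2 (\<lambda>w. h w $ 1)) 0
     in vector [l * z $ 1 + A * (z $ 2)\<^sup>2, m * z $ 2])"

end

theory Submission
  imports Defs "HOL-Complex_Analysis.Conformal_Mappings"
begin

text \<open>
  Give the coordinates \<open>z\<^sub>1, z\<^sub>2\<close> the weights 2 and 1 and put \<open>R\<^sub>\<zeta> z = (\<zeta>\<^sup>2 z\<^sub>1, \<zeta> z\<^sub>2)\<close>. The shearing of
  \<open>h\<close> is the limit of \<open>R\<^sub>\<zeta>\<^sup>-\<^sup>1 \<circ> h \<circ> R\<^sub>\<zeta>\<close> as \<open>\<zeta> \<rightarrow> 0\<close>: diagonality of the differential excludes the
  only term, \<open>z\<^sub>2\<close> in the first component, that would blow up. Conjugation is compatible with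
  composition, so shearing \<open>f\<^sub>s = f\<^sub>t \<circ> \<phi>\<close> amounts to shearing the transition map \<open>\<phi>\<close>. For
  \<open>\<bar>\<zeta>\<bar> = 1\<close> the map \<open>R\<^sub>\<zeta>\<close> is unitary, so \<open>R\<^sub>\<zeta>\<^sup>-\<^sup>1 (\<phi> (R\<^sub>\<zeta> z))\<close> stays in a compact part of the ball; the
  maximum principle in \<open>\<zeta>\<close> then puts the limit at \<open>\<zeta> = 0\<close> in the ball as well. Hence the sheared
  maps have increasing images (\<open>shearing_image_mono\<close>).
  
  The transition map \<open>\<phi> = f\<^sub>t\<^sup>-\<^sup>1 \<circ> f\<^sub>s\<close> is holomorphic, but for maps of several variables this rests on
  Osgood's theorem that univalent maps have nonvanishing Jacobian. The proof below goes around it. Invariance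
  of domain makes \<open>\<phi>\<close> continuous, and \<open>\<phi>\<close> is holomorphic where the Jacobian determinant \<open>J\<close> of
  \<open>f\<^sub>t\<close>, taken at the image point, is nonzero. For the maximum principle this suffices
  (\<open>maximum_modulus_off_zeros\<close>), provided that \<open>J\<close> is itself holomorphic along the
  curve; that is the purpose of the part on partial derivatives. The limit at \<open>\<zeta> = 0\<close> is computed
  from \<open>shear_expansion\<close>.
  
  The remaining properties concern the explicit polynomial maps \<open>(\<lambda> z\<^sub>1 + A z\<^sub>2\<^sup>2, \<lambda> z\<^sub>2)\<close>, which are
  injective for \<open>\<lambda> \<noteq> 0\<close>. Normality of the rescaled shearings is boundedness of the rescaled coefficient
  \<open>A\<close>, which Cauchy's inequality deduces from normality of the given chain.
\<close>

(* The notation $ is reserved for vector components. *)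
unbundle no fps_syntax

section \<open>Slices and holomorphic curves\<close>

lemma bounded_linear_axis: "bounded_linear (axis j :: 'a::euclidean_space \<Rightarrow> 'a^'n)"
  unfolding linear_conv_bounded_linear[symmetric]
  by (rule linearI) (auto simp: axis_def vec_eq_iff)

lemma norm_axis: "norm (axis j x) = norm (x::'a::real_inner)"
  unfolding norm_eq_sqrt_inner inner_axis_axis by (simp only: simp_thms if_True)

lemma axis_zero: "axis j 0 = (0 :: 'a::zero^'n)"
  by (simp add: axis_def vec_eq_iff)

text \<open>
  A derivative of the form \<open>\<lambda>h. h *s k\<close> is how complex differentiability of a curve
  \<open>complex \<Rightarrow> complex^'n\<close> is expressed below: such a derivative composes with the complex matrices
  of a holomorphic map, and its components are ordinary complex derivatives.
\<close>
lemma has_derivative_component: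
  assumes "(c has_derivative (\<lambda>h. h *s k)) (at (\<zeta>::complex))"
  shows "((\<lambda>\<zeta>. c \<zeta> $ i) has_field_derivative k $ i) (at \<zeta>)"
proof -
  have "((\<lambda>\<zeta>. c \<zeta> $ i) has_derivative (\<lambda>h. (h *s k) $ i)) (at \<zeta>)"
    by (rule bounded_linear.has_derivative[OF bounded_linear_vec_nth assms])
  moreover have "(\<lambda>h. (h *s k) $ i) = (*) (k $ i)"
    by (rule ext) (simp only: vector_smult_component mult.commute)
  ultimately show ?thesis unfolding has_field_derivative_def by metis
qed

lemma holomorphic_map_along_curve:
  fixes c :: "complex \<Rightarrow> complex^'n" and L :: "complex^'n^'m"
  assumes "(c has_derivative (\<lambda>h. h *s k)) (at \<zeta>)"
    and "(f has_derivative (\<lambda>v. L *v v)) (at (c \<zeta>))"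
  shows "((\<lambda>\<zeta>. f (c \<zeta>)) has_derivative (\<lambda>h. h *s (L *v k))) (at \<zeta>)"
  using has_derivative_compose[OF assms] by (simp add: vector_scalar_commute)

lemma has_derivative_axis_line:
  "((\<lambda>\<zeta>. a + axis j \<zeta> :: complex^'n) has_derivative (\<lambda>h. h *s axis j 1)) (at \<zeta>)"
proof -
  have "((\<lambda>\<zeta>. a + axis j \<zeta> :: complex^'n) has_derivative (\<lambda>h. 0 + axis j h)) (at \<zeta>)"
    by (intro has_derivative_add has_derivative_const bounded_linear.has_derivative[OF bounded_linear_axis] has_derivative_ident)
  moreover have "(\<lambda>h. 0 + axis j h) = (\<lambda>h::complex. h *s axis j 1 :: complex^'n)"
    by (auto simp: axis_def vec_eq_iff)
  ultimately show ?thesis by (simp only:)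
qed

lemma slice_has_field_derivative:
  fixes L :: "complex^'n^'m"
  assumes "(f has_derivative (\<lambda>v. L *v v)) (at (a + axis j \<zeta>))"
  shows "((\<lambda>\<zeta>. f (a + axis j \<zeta>) $ i) has_field_derivative L $ i $ j) (at \<zeta>)"
proof -
  have "((L::complex^'n^'m) *v axis j 1) $ i = (\<Sum>l\<in>UNIV. L $ i $ l * (if l = j then 1 else 0))"
    by (simp add: matrix_vector_mult_def axis_def)
  also have "\<dots> = (\<Sum>l\<in>UNIV. (if l = j then L $ i $ l else 0))"
    by (intro sum.cong) auto
  also have "\<dots> = L $ i $ j" by simp
  finally have eq: "(L *v axis j 1) $ i = L $ i $ j" .
  have "((\<lambda>\<zeta>. f (a + axis j \<zeta>)) has_derivative (\<lambda>h. h *s (L *v axis j 1))) (at \<zeta>)"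
    by (rule holomorphic_map_along_curve[OF has_derivative_axis_line assms])
  from has_derivative_component[OF this, of i] show ?thesis
    unfolding eq .
qed

lemma partial_deriv_eq:
  fixes L :: "complex^'n^'m"
  assumes "(f has_derivative (\<lambda>v. L *v v)) (at a)"
  shows "partial_deriv j (\<lambda>w. f w $ i) a = L $ i $ j"
proof -
  have "(f has_derivative (\<lambda>v. L *v v)) (at (a + axis j 0))"
    unfolding axis_zero using assms by (simp only: add_0_right)
  from DERIV_imp_deriv[OF slice_has_field_derivative[OF this, of i]]
  show ?thesis unfolding partial_deriv_def .
qed

lemma holomorphic_map_on_continuous: "holomorphic_map_on f S \<Longrightarrow> continuous_on S f"
  unfolding holomorphic_map_on_def
  by (meson continuous_at_imp_continuous_on has_derivative_continuous)

lemma slice_holomorphic: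
  assumes "holomorphic_map_on f S" "\<And>\<zeta>. \<zeta> \<in> D \<Longrightarrow> a + axis j \<zeta> \<in> S"
  shows "(\<lambda>\<zeta>. f (a + axis j \<zeta>) $ i) holomorphic_on D"
proof (unfold holomorphic_on_def, safe)
  fix \<zeta> assume "\<zeta> \<in> D"
  then obtain L where "(f has_derivative (\<lambda>v. L *v v)) (at (a + axis j \<zeta>))"
    using assms unfolding holomorphic_map_on_def by meson
  from slice_has_field_derivative[OF this, of i]
  show "(\<lambda>\<zeta>. f (a + axis j \<zeta>) $ i) field_differentiable (at \<zeta> within D)"
    using field_differentiable_at_within field_differentiable_def by blast
qed

lemma deriv_slice:
  "deriv (\<lambda>\<zeta>. g (a + axis j \<zeta>)) \<zeta> = partial_deriv j g (a + axis j \<zeta>)"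
proof -
  have "deriv (\<lambda>\<zeta>. g (a + axis j \<zeta>)) \<zeta> = deriv (\<lambda>\<xi>. g (a + axis j (\<zeta> + \<xi>))) 0"
    using deriv_shift_0[of "\<lambda>\<zeta>. g (a + axis j \<zeta>)" \<zeta>] by (simp add: o_def)
  moreover have "axis j (\<zeta> + \<xi>) = axis j \<zeta> + axis j \<xi>" for \<xi>
    by (auto simp: axis_def vec_eq_iff)
  ultimately show ?thesis by (simp add: partial_deriv_def add.assoc)
qed

section \<open>Holomorphy of partial derivatives\<close>

text \<open>
  The constant depends on \<open>k\<close> only through its bound \<open>M\<close>. This is what makes the difference
  quotients below converge uniformly in the base point. Cauchy's inequality is applied on discs of
  radius \<open>r/2\<close> about points of \<open>ball 0 (r/2)\<close>, hence the restriction on \<open>h\<close>.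
\<close>
lemma holomorphic_Taylor_remainder:
  assumes hol: "k holomorphic_on ball 0 r" and "0 < r"
    and M: "\<And>\<zeta>. \<zeta> \<in> ball 0 r \<Longrightarrow> norm (k \<zeta>) \<le> M" and "norm h < r/2"
  shows "norm (k h - (\<Sum>i\<le>n. (deriv ^^ i) k 0 * h^i / fact i))
           \<le> (fact (Suc n) * M / (r/2)^Suc n) * norm h ^ Suc n / fact n"
proof -
  have "norm ((deriv ^^ 0) k h - (\<Sum>i\<le>n. (deriv ^^ i) k 0 * (h - 0)^i / fact i))
           \<le> (fact (Suc n) * M / (r/2)^Suc n) * norm (h - 0) ^ Suc n / fact n"
  proof (rule complex_Taylor[where S = "ball 0 (r/2)" and f = "\<lambda>i. (deriv ^^ i) k"])
    fix i x assume "x \<in> ball (0::complex) (r/2)"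
    then have x: "x \<in> ball 0 r" using \<open>0 < r\<close> by auto
    have "(deriv ^^ i) k holomorphic_on ball 0 r"
      by (intro holomorphic_higher_deriv hol) auto
    from holomorphic_derivI[OF this _ x]
    show "((deriv ^^ i) k has_field_derivative (deriv ^^ Suc i) k x) (at x within ball 0 (r/2))"
      by auto
  next
    fix x assume x: "x \<in> ball (0::complex) (r/2)"
    have sub: "cball x (r/2) \<subseteq> ball 0 r"
    proof
      fix y assume "y \<in> cball x (r/2)"
      then show "y \<in> ball 0 r" using x norm_triangle_ineq[of x "y - x"]
        by (auto simp: dist_norm norm_minus_commute)
    qed
    show "norm ((deriv ^^ Suc n) k x) \<le> fact (Suc n) * M / (r/2)^Suc n"
    proof (rule Cauchy_inequality)
      show "k holomorphic_on ball x (r/2)"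
        using hol sub by (meson ball_subset_cball holomorphic_on_subset)
      show "continuous_on (cball x (r/2)) k"
        using hol sub by (meson continuous_on_subset holomorphic_on_imp_continuous_on)
      show "norm (k y) \<le> M" if "norm (x - y) = r/2" for y
        using that sub M[of y] by (auto simp: dist_norm subset_iff)
    qed (use \<open>0<r\<close> in auto)
  qed (use assms in auto)
  then show ?thesis by simp
qed

text \<open>
  All slices in direction \<open>j\<close> through points of \<open>K\<close> are holomorphic on discs of one radius and
  share one bound, since a closed neighbourhood of \<open>K\<close> is compact; so the remainder estimate holds
  with the same constants for all of them.
\<close>
lemma partial_deriv_remainder:
  fixes f :: "complex^'n \<Rightarrow> complex^'m"
  assumes hol: "holomorphic_map_on f S" and "open S" "compact K" "K \<subseteq> S"
  obtains r C where "r > 0" and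
    "\<And>w h. w \<in> K \<Longrightarrow> norm h < r \<Longrightarrow> w + axis j h \<in> S \<and>
       norm (f (w + axis j h) $ i - f w $ i - partial_deriv j (\<lambda>w. f w $ i) w * h) \<le> C * norm h ^ 2"
proof -
  obtain e where "e > 0" and e: "(\<Union>x\<in>K. cball x e) \<subseteq> S"
    using compact_subset_open_imp_cball_epsilon_subset[OF assms(3,2,4)] .
  let ?K = "{x + y |x y. x \<in> K \<and> y \<in> cball 0 e}"
  have "compact ?K" by (intro compact_sums \<open>compact K\<close> compact_cball)
  moreover have KS: "?K \<subseteq> S" using e by (force simp: dist_norm)
  ultimately have "bounded (f ` ?K)"
    using holomorphic_map_on_continuous[OF hol]
    by (meson compact_continuous_image compact_imp_bounded continuous_on_subset)
  then obtain M where M: "\<And>w. w \<in> ?K \<Longrightarrow> norm (f w) \<le> M"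
    unfolding bounded_iff by blast
  show thesis
  proof (rule that[of "e/2"])
    fix w :: "complex^'n" and h :: complex assume w: "w \<in> K" and h: "norm h < e/2"
    define k where "k = (\<lambda>\<zeta>. f (w + axis j \<zeta>) $ i)"
    have inK: "w + axis j \<zeta> \<in> ?K" if "norm \<zeta> < e" for \<zeta>
      using w that by (intro CollectI exI[of _ w] exI[of _ "axis j \<zeta>"]) (auto simp: norm_axis)
    have "norm (k h - (\<Sum>i\<le>1. (deriv ^^ i) k 0 * h^i / fact i))
       \<le> (fact (Suc 1) * M / (e/2)^Suc 1) * norm h ^ Suc 1 / fact 1"
    proof (rule holomorphic_Taylor_remainder[OF _ \<open>e > 0\<close> _ h])
      show "k holomorphic_on ball 0 e"
        unfolding k_def using KS inK by (intro slice_holomorphic[OF hol]) auto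
      show "norm (k \<zeta>) \<le> M" if "\<zeta> \<in> ball 0 e" for \<zeta>
        using M[OF inK[of \<zeta>]] that Finite_Cartesian_Product.norm_nth_le[of "f (w + axis j \<zeta>)" i] unfolding k_def by auto
    qed
    moreover have "deriv k 0 = partial_deriv j (\<lambda>w. f w $ i) w"
      by (simp add: k_def partial_deriv_def)
    ultimately have "norm (f (w + axis j h) $ i - f w $ i - partial_deriv j (\<lambda>w. f w $ i) w * h)
        \<le> (2 * M / (e/2)^2) * norm h ^ 2"
      by (simp add: k_def axis_zero diff_diff_eq power2_eq_square)
    then show "w + axis j h \<in> S \<and> norm (f (w + axis j h) $ i - f w $ i - partial_deriv j (\<lambda>w. f w $ i) w * h)
        \<le> (2 * M / (e/2)^2) * norm h ^ 2"
      using inK[of h] KS h \<open>e > 0\<close> by auto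
  qed (use \<open>e > 0\<close> in auto)
qed

text \<open>
  The shift by \<open>N\<close> keeps every shifted point inside \<open>S\<close>, so that each quotient, and not only those
  far out in the sequence, inherits continuity and holomorphy from \<open>f\<close>.
\<close>
lemma difference_quotients_converge:
  fixes f :: "complex^'n \<Rightarrow> complex^'m"
  assumes hol: "holomorphic_map_on f S" and "open S" "compact K" "K \<subseteq> S"
  obtains N where
    "\<And>n w. w \<in> K \<Longrightarrow> w + axis j (1 / of_nat (Suc (n + N))) \<in> S"
    "uniform_limit K (\<lambda>n w. (f (w + axis j (1 / of_nat (Suc (n + N)))) $ i - f w $ i) * of_nat (Suc (n + N)))
        (partial_deriv j (\<lambda>w. f w $ i)) sequentially"
proof -
  let ?d = "partial_deriv j (\<lambda>w. f w $ i)"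
  obtain r C where "r > 0" and rC: 
    "\<And>w h. w \<in> K \<Longrightarrow> norm h < r \<Longrightarrow> w + axis j h \<in> S \<and>
       norm (f (w + axis j h) $ i - f w $ i - ?d w * h) \<le> C * norm h ^ 2"
    using partial_deriv_remainder[OF assms, where j=j and i=i] by metis
  obtain N where N: "1 / real (Suc N) < r"
    using \<open>r > 0\<close> by (metis nat_approx_posE)
  have small: "norm (1 / of_nat (Suc (n + N)) :: complex) < r" for n
  proof -
    have "1 / real (Suc (n + N)) \<le> 1 / real (Suc N)" by (intro divide_left_mono) auto
    with N show ?thesis by (simp only: norm_divide norm_of_nat norm_one)
  qed
  show thesis
  proof
    show "w + axis j (1 / of_nat (Suc (n + N))) \<in> S" if "w \<in> K" for n w
      using rC[OF that small] by blast
    show "uniform_limit K (\<lambda>n w. (f (w + axis j (1 / of_nat (Suc (n + N)))) $ i - f w $ i) * of_nat (Suc (n + N)))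
        ?d sequentially"
    proof (rule uniform_limitI)
      fix e :: real assume "e > 0"
      have "(\<lambda>n. \<bar>C\<bar> * (1 / real (Suc (n + N)))) \<longlonglongrightarrow> \<bar>C\<bar> * 0"
        by (intro tendsto_mult tendsto_const LIMSEQ_ignore_initial_segment[of "\<lambda>n. 1 / real (Suc n)"]) 
           (rule LIMSEQ_Suc[OF lim_1_over_n])
      then have "\<forall>\<^sub>F n in sequentially. \<bar>C\<bar> * (1 / real (Suc (n + N))) < e"
        using \<open>e > 0\<close> by (simp add: order_tendstoD)
      then show "\<forall>\<^sub>F n in sequentially. \<forall>w\<in>K. dist ((f (w + axis j (1 / of_nat (Suc (n + N)))) $ i - f w $ i) * of_nat (Suc (n + N))) (?d w) < e"
      proof (rule eventually_mono, safe)
        fix n w assume n: "\<bar>C\<bar> * (1 / real (Suc (n + N))) < e" and "w \<in> K"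
        define m where "m = Suc (n + N)"
        define h where "h = 1 / (of_nat m :: complex)"
        define D where "D = f (w + axis j h) $ i - f w $ i"
        have m: "(of_nat m :: complex) \<noteq> 0" unfolding m_def by (simp only: of_nat_eq_0_iff)
        have "D * of_nat m - ?d w = (D - ?d w * h) * of_nat m"
          using m by (simp add: h_def field_simps)
        then have "norm (D * of_nat m - ?d w) = norm (D - ?d w * h) * real m"
          by (simp add: norm_mult)
        also have "\<dots> \<le> (C * norm h ^ 2) * real m"
          using rC[OF \<open>w \<in> K\<close> small[of n]] unfolding D_def h_def m_def
          by (intro mult_right_mono) auto
        also have "\<dots> = C * (1 / real m)"
          using m by (simp add: h_def norm_divide power2_eq_square)
        also have "\<dots> \<le> \<bar>C\<bar> * (1 / real m)" by (intro mult_right_mono) auto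
        also have "\<dots> < e" using n by (simp add: m_def)
        finally show "dist ((f (w + axis j (1 / of_nat (Suc (n + N)))) $ i - f w $ i) * of_nat (Suc (n + N))) (?d w) < e"
          unfolding D_def h_def m_def dist_norm .
      qed
    qed
  qed
qed

lemma partial_deriv_continuous:
  fixes f :: "complex^'n \<Rightarrow> complex^'m"
  assumes hol: "holomorphic_map_on f S" and "open S"
  shows "continuous_on S (partial_deriv j (\<lambda>w. f w $ i))"
proof (rule continuous_at_imp_continuous_on, rule ballI)
  fix x assume "x \<in> S"
  then obtain d where "d > 0" and d: "cball x d \<subseteq> S"
    using \<open>open S\<close> open_contains_cball by blast
  obtain N where N: "\<And>n w. w \<in> cball x d \<Longrightarrow> w + axis j (1 / of_nat (Suc (n + N))) \<in> S"
    "uniform_limit (cball x d) (\<lambda>n w. (f (w + axis j (1 / of_nat (Suc (n + N)))) $ i - f w $ i) * of_nat (Suc (n + N)))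
        (partial_deriv j (\<lambda>w. f w $ i)) sequentially"
    using difference_quotients_converge[OF hol \<open>open S\<close> compact_cball d] by blast
  note cf = holomorphic_map_on_continuous[OF hol]
  have "continuous_on (cball x d) (partial_deriv j (\<lambda>w. f w $ i))"
  proof (rule uniform_limit_theorem[OF _ N(2)])
    show "\<forall>\<^sub>F n in sequentially. continuous_on (cball x d)
       (\<lambda>w. (f (w + axis j (1 / of_nat (Suc (n + N)))) $ i - f w $ i) * of_nat (Suc (n + N)))"
      using N(1) d
      by (intro always_eventually allI continuous_intros continuous_on_compose2[OF cf]) auto
  qed simp
  then show "isCont (partial_deriv j (\<lambda>w. f w $ i)) x"
    by (rule continuous_on_interior) (use \<open>d > 0\<close> in auto)
qed

text \<open>
  Restricted to a holomorphic curve, the partial derivatives are locally uniform limits of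
  difference quotients that are holomorphic in one variable, and Weierstrass' theorem applies. The
  maximum principle below uses the Jacobian determinant along curves only.
\<close>
lemma partial_deriv_along_curve:
  fixes f :: "complex^'n \<Rightarrow> complex^'m" and c :: "complex \<Rightarrow> complex^'n"
  assumes hol: "holomorphic_map_on f S" and "open S" "open D"
    and c: "\<And>\<zeta>. \<zeta> \<in> D \<Longrightarrow> \<exists>k. (c has_derivative (\<lambda>h. h *s k)) (at \<zeta>)"
    and cS: "c ` D \<subseteq> S"
  shows "(\<lambda>\<zeta>. partial_deriv j (\<lambda>w. f w $ i) (c \<zeta>)) holomorphic_on D"
proof -
  let ?d = "partial_deriv j (\<lambda>w. f w $ i)"
  have "(\<lambda>\<zeta>. ?d (c \<zeta>)) field_differentiable (at x)" if "x \<in> D" for x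
  proof -
    obtain d where "d > 0" and d: "cball x d \<subseteq> D"
      using \<open>open D\<close> open_contains_cball \<open>x \<in> D\<close> by blast
    have cc: "continuous_on D c"
      by (meson c continuous_at_imp_continuous_on has_derivative_continuous)
    have "compact (c ` cball x d)"
      using cc d by (meson compact_cball compact_continuous_image continuous_on_subset)
    moreover have "c ` cball x d \<subseteq> S" using d cS by blast
    ultimately obtain N where N: "\<And>n w. w \<in> c ` cball x d \<Longrightarrow> w + axis j (1 / of_nat (Suc (n + N))) \<in> S"
      "uniform_limit (c ` cball x d) (\<lambda>n w. (f (w + axis j (1 / of_nat (Suc (n + N)))) $ i - f w $ i) * of_nat (Suc (n + N)))
          ?d sequentially"
      using difference_quotients_converge[OF hol \<open>open S\<close>, of "c ` cball x d" j i] by blast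
    have fc: "(\<lambda>\<zeta>. f (a + c \<zeta>) $ i) holomorphic_on ball x d" 
      if acS: "\<And>\<zeta>. \<zeta> \<in> ball x d \<Longrightarrow> a + c \<zeta> \<in> S" for a
    proof (unfold holomorphic_on_def, safe)
      fix \<zeta> assume z: "\<zeta> \<in> ball x d"
      then obtain k where "(c has_derivative (\<lambda>h. h *s k)) (at \<zeta>)" using c d by force
      then have "((\<lambda>\<zeta>. a + c \<zeta>) has_derivative (\<lambda>h. h *s k)) (at \<zeta>)"
        by (auto intro!: derivative_eq_intros)
      moreover obtain L where "(f has_derivative (\<lambda>v. L *v v)) (at (a + c \<zeta>))"
        using hol acS[OF z] unfolding holomorphic_map_on_def by blast
      ultimately show "(\<lambda>\<zeta>. f (a + c \<zeta>) $ i) field_differentiable (at \<zeta> within ball x d)"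
        using has_derivative_component holomorphic_map_along_curve
          field_differentiable_at_within field_differentiable_def by blast
    qed
    have "(\<lambda>\<zeta>. ?d (c \<zeta>)) holomorphic_on ball x d"
    proof (rule holomorphic_uniform_sequence)
      show "(\<lambda>\<zeta>. (f (c \<zeta> + axis j (1 / of_nat (Suc (n + N)))) $ i - f (c \<zeta>) $ i) * of_nat (Suc (n + N)))
              holomorphic_on ball x d" for n
        using fc[of 0] fc[of "axis j (1 / of_nat (Suc (n + N)))"] N(1)[of _ n] d cS
        by (intro holomorphic_intros) (auto simp: add.commute[of _ "axis j _"] image_subset_iff subset_iff)
      show "\<exists>d'>0. cball y d' \<subseteq> ball x d \<and> uniform_limit (cball y d')
          (\<lambda>n \<zeta>. (f (c \<zeta> + axis j (1 / of_nat (Suc (n + N)))) $ i - f (c \<zeta>) $ i) * of_nat (Suc (n + N)))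
          (\<lambda>\<zeta>. ?d (c \<zeta>)) sequentially" if y: "y \<in> ball x d" for y
      proof -
        obtain d' where "d' > 0" "cball y d' \<subseteq> ball x d"
          using y by (metis open_ball open_contains_cball)
        moreover have "uniform_limit (ball x d)
          (\<lambda>n \<zeta>. (f (c \<zeta> + axis j (1 / of_nat (Suc (n + N)))) $ i - f (c \<zeta>) $ i) * of_nat (Suc (n + N)))
          (\<lambda>\<zeta>. ?d (c \<zeta>)) sequentially"
        proof (rule uniform_limitI)
          fix e :: real assume "e > 0"
          from uniform_limitD[OF N(2) this]
          show "\<forall>\<^sub>F n in sequentially. \<forall>\<zeta>\<in>ball x d. dist ((f (c \<zeta> + axis j (1 / of_nat (Suc (n + N)))) $ i - f (c \<zeta>) $ i) * of_nat (Suc (n + N))) (?d (c \<zeta>)) < e"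
            by (rule eventually_mono) auto
        qed
        ultimately show ?thesis using uniform_limit_on_subset by blast
      qed
    qed auto
    then show ?thesis
      using \<open>d > 0\<close> by (meson centre_in_ball holomorphic_on_imp_differentiable_at open_ball)
  qed
  then show ?thesis
    using field_differentiable_at_within holomorphic_on_def by blast
qed

section \<open>A maximum principle with an exceptional zero set\<close>

text \<open>
  Holomorphy of \<open>\<psi>\<close> is known only off the zeros of \<open>J\<close>, which keeps the maximum principle
  for \<open>\<psi>\<close> itself out of reach. But \<open>\<psi>^n * J\<close> vanishes at these zeros, so on the open set where \<open>J \<noteq> 0\<close> the
  maximum modulus principle bounds \<open>\<psi>^n * J\<close> by its values on the unit circle. Thus
  \<open>\<bar>\<psi> 0\<bar>^n * \<bar>J 0\<bar> \<le> m^n * max \<bar>J\<bar>\<close>, and the factors not raised to the power \<open>n\<close> are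
  immaterial as \<open>n\<close> tends to infinity.
\<close>
lemma maximum_modulus_off_zeros:
  fixes \<psi> J :: "complex \<Rightarrow> complex"
  assumes cpsi: "continuous_on (cball 0 1) \<psi>" and cJ: "continuous_on (cball 0 1) J"
    and hpsi: "\<psi> holomorphic_on {\<zeta>\<in>ball 0 1. J \<zeta> \<noteq> 0}"
    and hJ: "J holomorphic_on {\<zeta>\<in>ball 0 1. J \<zeta> \<noteq> 0}"
    and J0: "J 0 \<noteq> 0"
    and m: "\<And>\<zeta>. norm \<zeta> = 1 \<Longrightarrow> norm (\<psi> \<zeta>) \<le> m"
  shows "norm (\<psi> 0) \<le> m"
proof (rule ccontr)
  let ?O = "{\<zeta>\<in>ball 0 1. J \<zeta> \<noteq> 0}"
  assume "\<not> norm (\<psi> 0) \<le> m"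
  moreover have "0 \<le> m" using order_trans[OF norm_ge_zero m[of 1]] by simp
  ultimately have m0: "0 \<le> m" and lt: "m < norm (\<psi> 0)" by simp_all
  then have pos: "norm (\<psi> 0) > 0" by linarith
  have q: "0 \<le> m / norm (\<psi> 0)" "m / norm (\<psi> 0) < 1"
    using m0 lt pos by (simp_all only: divide_less_eq_1_pos zero_le_divide_iff) auto
  have "open (ball 0 1 \<inter> J -` (- {0}))"
    using cJ by (intro continuous_open_preimage) (auto intro: continuous_on_subset)
  moreover have "ball 0 1 \<inter> J -` (- {0}) = ?O" by auto
  ultimately have opn: "open ?O" by simp
  have clos: "closure ?O \<subseteq> cball 0 1" by (rule closure_minimal) auto
  have "bounded (J ` cball 0 1)"
    using cJ compact_cball compact_continuous_image compact_imp_bounded by blast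
  then obtain C where C: "\<And>\<zeta>. \<zeta> \<in> cball 0 1 \<Longrightarrow> norm (J \<zeta>) \<le> C"
    unfolding bounded_iff by blast
  have "0 \<le> C" using order_trans[OF norm_ge_zero C[of 0]] by simp
  have est: "norm (J 0) \<le> (m / norm (\<psi> 0)) ^ n * C" for n
  proof -
    have "norm (\<psi> 0 ^ n * J 0) \<le> m ^ n * C"
    proof (rule maximum_modulus_frontier[where S = ?O and f = "\<lambda>\<zeta>. \<psi> \<zeta> ^ n * J \<zeta>"])
      show "(\<lambda>\<zeta>. \<psi> \<zeta> ^ n * J \<zeta>) holomorphic_on interior ?O"
        unfolding interior_open[OF opn] by (intro holomorphic_intros hpsi hJ)
      show "continuous_on (closure ?O) (\<lambda>\<zeta>. \<psi> \<zeta> ^ n * J \<zeta>)"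
        by (intro continuous_intros continuous_on_subset[OF cpsi clos] continuous_on_subset[OF cJ clos])
      show "bounded ?O" by (rule bounded_subset[of "ball 0 1"]) auto
      show "norm (\<psi> z ^ n * J z) \<le> m ^ n * C" if "z \<in> frontier ?O" for z
      proof -
        have "z \<in> cball 0 1" "z \<notin> ?O"
          using that clos unfolding frontier_def interior_open[OF opn] by auto
        then consider "norm z = 1" | "J z = 0" by fastforce
        then show ?thesis
        proof cases
          case 1
          then show ?thesis using m[of z] C[of z] m0
            by (auto simp: norm_mult norm_power intro!: mult_mono power_mono)
        qed (use m0 \<open>0 \<le> C\<close> in auto)
      qed
      show "0 \<in> ?O" using J0 by simp
    qed
    then show ?thesis using pos by (simp add: norm_mult norm_power power_divide field_simps)
  qed
  have "(\<lambda>n. (m / norm (\<psi> 0)) ^ n * C) \<longlonglongrightarrow> 0 * C"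
    using q by (intro tendsto_mult tendsto_const LIMSEQ_power_zero) auto
  then have "norm (J 0) \<le> 0 * C"
    by (rule LIMSEQ_le_const) (use est in blast)
  with J0 show False by simp
qed

section \<open>The weighted expansion at the origin\<close>

lemma slice_derivative:
  fixes f :: "complex^'n \<Rightarrow> complex^'m"
  assumes "holomorphic_map_on f S" "a + axis j \<zeta> \<in> S"
  shows "((\<lambda>\<zeta>. f (a + axis j \<zeta>) $ i) has_field_derivative
           partial_deriv j (\<lambda>w. f w $ i) (a + axis j \<zeta>)) (at \<zeta>)"
proof -
  obtain L where L: "(f has_derivative (\<lambda>v. L *v v)) (at (a + axis j \<zeta>))"
    using assms unfolding holomorphic_map_on_def by blast
  show ?thesis
    using slice_has_field_derivative[OF L] unfolding partial_deriv_eq[OF L] .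
qed

lemma norm_vec2: "norm (z :: complex^2) = sqrt ((norm (z$1))\<^sup>2 + (norm (z$2))\<^sup>2)"
  by (simp add: norm_vec_def L2_set_def sum_2)

lemma eq_axis_sum: "(z :: complex^2) = axis 2 (z$2) + axis 1 (z$1)"
  by (simp add: vec_eq_iff forall_2 axis_def)

text \<open>
  If \<open>p$1\<close> has weight 2 and \<open>p$2\<close> has weight 1, the displayed right-hand side is, up to the
  deviation of \<open>q\<close> and \<open>B\<close> from their limits, the part of weight 2 of a component of \<open>f\<close>. The
  factor \<open>q\<close> is the mean slope in the first variable, close to the partial derivative at 0 because
  that is continuous; \<open>B\<close> is the quotient by \<open>v\<^sup>2\<close> of the restriction to the second axis. The
  factorized form, unlike an error estimate, survives the substitution of curves whose first
  component is not yet known to be of order 2.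
\<close>
lemma shear_expansion:
  fixes f :: "complex^2 \<Rightarrow> complex^'m"
  assumes hol: "holomorphic_map_on f (ball 0 1)" and f0: "f 0 $ i = 0"
    and d2: "partial_deriv 2 (\<lambda>w. f w $ i) 0 = 0"
  obtains q B where
    "(q \<longlongrightarrow> partial_deriv 1 (\<lambda>w. f w $ i) 0) (nhds 0)"
    "(B \<longlongrightarrow> 1/2 * partial_deriv 2 (partial_deriv 2 (\<lambda>w. f w $ i)) 0) (nhds 0)"
    "\<And>p. p \<in> ball 0 1 \<Longrightarrow> f p $ i = q p * p $ 1 + B (p $ 2) * (p $ 2)\<^sup>2"
proof -
  define l where "l = partial_deriv 1 (\<lambda>w. f w $ i) 0"
  define A where "A = 1/2 * partial_deriv 2 (partial_deriv 2 (\<lambda>w. f w $ i)) 0"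
  define k where "k = (\<lambda>v. f (0 + axis 2 v) $ i)"
  define q where "q = (\<lambda>p::complex^2. if p$1 = 0 then l else (f p $ i - k (p$2)) / p$1)"
  define B where "B = (\<lambda>v. if v = 0 then A else k v / v\<^sup>2)"
  have k0: "k 0 = 0" using f0 by (simp add: k_def axis_zero)
  have qlim: "(q \<longlongrightarrow> l) (nhds 0)"
  proof (rule tendstoI)
    fix e :: real assume "e > 0"
    have "isCont (partial_deriv 1 (\<lambda>w. f w $ i)) 0"
      using partial_deriv_continuous[OF hol open_ball]
      by (metis centre_in_ball continuous_on_eq_continuous_at open_ball zero_less_one)
    then obtain d where "d > 0" and
      d: "\<And>w. norm w < d \<Longrightarrow> norm (partial_deriv 1 (\<lambda>w. f w $ i) w - l) < e/2"
      unfolding continuous_at_eps_delta l_def using \<open>e > 0\<close>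
      by (metis dist_norm diff_zero half_gt_zero)
    define d' where "d' = min d 1 / 2"
    have "dist (q p) l < e" if p: "norm p < d'" for p
    proof (cases "p$1 = 0")
      case False
      define D where "D = (\<lambda>u. f (axis 2 (p$2) + axis 1 u) $ i - l * u)"
      have small: "norm (axis 2 (p$2) + axis 1 u :: complex^2) < min d 1" if "norm u \<le> norm (p$1)" for u :: complex
      proof -
        have "norm (axis 2 (p$2) + axis 1 u :: complex^2) \<le> norm (p$2) + norm u"
          using norm_triangle_ineq[of "axis 2 (p$2) :: complex^2" "axis 1 u"] by (simp only: norm_axis)
        also have "\<dots> \<le> norm p + norm p"
          using that Finite_Cartesian_Product.norm_nth_le[of p 1] Finite_Cartesian_Product.norm_nth_le[of p 2] by linarith
        finally show ?thesis using p unfolding d'_def by linarith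
      qed
      have "norm (D (p$1) - D 0) \<le> e/2 * norm (p$1 - 0)"
      proof (rule field_differentiable_bound[where S = "cball 0 (norm (p$1))"])
        fix u :: complex assume "u \<in> cball 0 (norm (p$1))"
        then have u: "norm u \<le> norm (p$1)" by simp
        have "(D has_field_derivative partial_deriv 1 (\<lambda>w. f w $ i) (axis 2 (p$2) + axis 1 u) - l * 1) (at u)"
          unfolding D_def using small[OF u]
          by (intro DERIV_diff slice_derivative[OF hol] DERIV_cmult DERIV_ident) auto
        then show "(D has_field_derivative partial_deriv 1 (\<lambda>w. f w $ i) (axis 2 (p$2) + axis 1 u) - l) (at u within cball 0 (norm (p$1)))"
          by (simp add: has_field_derivative_at_within)
        show "norm (partial_deriv 1 (\<lambda>w. f w $ i) (axis 2 (p$2) + axis 1 u) - l) \<le> e/2"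
          using d[of "axis 2 (p$2) + axis 1 u"] small[OF u] by linarith
      qed auto
      moreover have "D (p$1) - D 0 = (q p - l) * p$1"
        using False eq_axis_sum[of p] by (simp add: D_def q_def k_def axis_zero field_simps)
      ultimately have "norm (q p - l) * norm (p$1) \<le> e/2 * norm (p$1)" by (simp add: norm_mult)
      then have "norm (q p - l) \<le> e/2" using False by simp
      then show ?thesis using \<open>e > 0\<close> by (simp add: dist_norm)
    qed (use \<open>e > 0\<close> in \<open>simp add: q_def\<close>)
    moreover have "d' > 0" using \<open>d > 0\<close> by (simp add: d'_def)
    ultimately show "\<forall>\<^sub>F p in nhds 0. dist (q p) l < e"
      unfolding eventually_nhds_metric by (metis dist_0_norm dist_commute)
  qed
  have Blim: "(B \<longlongrightarrow> A) (nhds 0)"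
  proof -
    have "bounded (f ` cball 0 (1/2))"
      by (intro compact_imp_bounded compact_continuous_image compact_cball
            continuous_on_subset[OF holomorphic_map_on_continuous[OF hol]]) auto
    then obtain M where M: "\<And>w. w \<in> cball 0 (1/2) \<Longrightarrow> norm (f w) \<le> M"
      unfolding bounded_iff by blast
    define C where "C = 3 * M / (1/4)^3"
    have est: "norm (B v - A) \<le> \<bar>C\<bar> * norm v" if v: "norm v < 1/4" for v
    proof (cases "v = 0")
      case False
      have "norm (k v - (\<Sum>i\<le>2. (deriv ^^ i) k 0 * v^i / fact i))
       \<le> (fact (Suc 2) * M / ((1/2)/2)^Suc 2) * norm v ^ Suc 2 / fact 2"
      proof (rule holomorphic_Taylor_remainder)
        show "k holomorphic_on ball 0 (1/2)"
          unfolding k_def by (rule slice_holomorphic[OF hol]) (auto simp: norm_axis)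
        show "norm (k \<zeta>) \<le> M" if "\<zeta> \<in> ball 0 (1/2)" for \<zeta>
        proof -
          have "norm (f (0 + axis 2 \<zeta>)) \<le> M" by (rule M) (use that in \<open>simp add: norm_axis\<close>)
          then show ?thesis
            unfolding k_def using Finite_Cartesian_Product.norm_nth_le[of "f (0 + axis 2 \<zeta>)" i] by linarith
        qed
      qed (use v in auto)
      moreover have "deriv k = (\<lambda>v. partial_deriv 2 (\<lambda>w. f w $ i) (0 + axis 2 v))"
        unfolding k_def by (rule ext, rule deriv_slice)
      then have "deriv k 0 = 0" "deriv (deriv k) 0 = 2 * A"
        using d2 by (simp_all add: axis_zero A_def partial_deriv_def[of 2 "partial_deriv 2 _"])
      ultimately have "norm (k v - A * v\<^sup>2) \<le> C * norm v ^ 3"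
        using k0 by (simp add: C_def eval_nat_numeral fact_numeral)
      also have "\<dots> \<le> \<bar>C\<bar> * norm v ^ 3" by (intro mult_right_mono) auto
      finally have "norm (k v - A * v\<^sup>2) / norm v ^ 2 \<le> \<bar>C\<bar> * norm v"
        using False by (simp add: field_simps eval_nat_numeral)
      moreover have "B v - A = (k v - A * v\<^sup>2) / v\<^sup>2" using False by (simp add: B_def field_simps)
      ultimately show ?thesis by (simp add: norm_divide norm_power)
    qed (simp add: B_def)
    have "((\<lambda>v::complex. \<bar>C\<bar> * norm v) \<longlongrightarrow> \<bar>C\<bar> * norm (0::complex)) (nhds 0)"
      by (rule tendsto_mult[OF tendsto_const tendsto_norm[OF filterlim_ident]])
    then have "((\<lambda>v. B v - A) \<longlongrightarrow> 0) (nhds 0)"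
    proof (intro Lim_null_comparison[of "\<lambda>v. B v - A" "\<lambda>v. \<bar>C\<bar> * norm v"])
      show "\<forall>\<^sub>F v in nhds 0. norm (B v - A) \<le> \<bar>C\<bar> * norm v"
        unfolding eventually_nhds_metric by (intro exI[of _ "1/4"]) (auto intro!: est)
    qed simp
    then show ?thesis by (simp add: LIM_zero_iff)
  qed
  show thesis
  proof (rule that[OF qlim[unfolded l_def] Blim[unfolded A_def]])
    fix p :: "complex^2" assume "p \<in> ball 0 1"
    show "f p $ i = q p * p $ 1 + B (p $ 2) * (p $ 2)\<^sup>2"
    proof (cases "p$1 = 0")
      case True
      then have "p = axis 2 (p$2)" using eq_axis_sum[of p] by (simp add: axis_zero)
      then have "f p $ i = k (p$2)" unfolding k_def by simp
      then show ?thesis using True k0 by (simp add: B_def)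
    qed (use k0 in \<open>auto simp: B_def q_def\<close>)
  qed
qed

section \<open>Univalent maps and their inverses\<close>

definition jacobian :: "(complex^'n \<Rightarrow> complex^'m) \<Rightarrow> complex^'n \<Rightarrow> complex^'n^'m" where
  "jacobian f w = (\<chi> i j. partial_deriv j (\<lambda>w. f w $ i) w)"

lemma jacobian_eq:
  "(f has_derivative (\<lambda>v. L *v v)) (at w) \<Longrightarrow> jacobian f w = L"
  by (simp add: jacobian_def vec_eq_iff partial_deriv_eq)

lemma det_jacobian_continuous:
  fixes f :: "complex^'n \<Rightarrow> complex^'n"
  assumes "holomorphic_map_on f S" "open S"
  shows "continuous_on S (\<lambda>w. det (jacobian f w))"
  unfolding det_def jacobian_def
  by (simp only: vec_lambda_beta) (intro continuous_intros partial_deriv_continuous[OF assms])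

lemma det_jacobian_along_curve:
  fixes f :: "complex^'n \<Rightarrow> complex^'n" and c :: "complex \<Rightarrow> complex^'n"
  assumes "holomorphic_map_on f S" "open S" "open D"
    "\<And>\<zeta>. \<zeta> \<in> D \<Longrightarrow> \<exists>k. (c has_derivative (\<lambda>h. h *s k)) (at \<zeta>)" "c ` D \<subseteq> S"
  shows "(\<lambda>\<zeta>. det (jacobian f (c \<zeta>))) holomorphic_on D"
  unfolding det_def jacobian_def
  by (simp only: vec_lambda_beta) (intro holomorphic_intros partial_deriv_along_curve[OF assms])

lemma univalent_inverse_continuous:
  fixes f :: "complex^'n \<Rightarrow> complex^'n"
  assumes "univalent_on f S" "open S"
  shows "continuous_on (f ` S) (inv_into S f)"
  using assms by (intro continuous_on_inverse_open)
    (auto simp: univalent_on_def holomorphic_map_on_continuous)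

text \<open>
  This is the pointwise inverse function theorem; points where the Jacobian determinant might
  vanish are left to \<open>maximum_modulus_off_zeros\<close>.
\<close>
lemma univalent_inverse_has_derivative:
  fixes f :: "complex^'n \<Rightarrow> complex^'n"
  assumes f: "univalent_on f S" and S: "open S" "w \<in> S" and J: "det (jacobian f w) \<noteq> 0"
  obtains M where "(inv_into S f has_derivative (\<lambda>v. M *v v)) (at (f w))"
proof -
  obtain L where L: "(f has_derivative (\<lambda>v. L *v v)) (at w)"
    using f \<open>w \<in> S\<close> unfolding univalent_on_def holomorphic_map_on_def by blast
  then have "invertible L" using J by (simp add: jacobian_eq invertible_det_nz)
  then obtain M where "L ** M = mat 1" unfolding invertible_def by blast
  then have "(\<lambda>v. L *v v) \<circ> (\<lambda>v. M *v v) = id"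
    by (auto simp: fun_eq_iff matrix_vector_mul_assoc)
  then have "(inv_into S f has_derivative (\<lambda>v. M *v v)) (at (f w))"
    using f by (intro has_derivative_inverse_strong[OF S _ _ L])
      (auto simp: univalent_on_def holomorphic_map_on_continuous)
  then show thesis by (rule that)
qed

section \<open>Shearings as limits of weighted dilations\<close>

text \<open>
  With weight 2 on the first coordinate and 1 on the second, the shearing of \<open>h\<close> is the limit as
  \<open>\<zeta> \<rightarrow> 0\<close> of the conjugate of \<open>h\<close> by \<open>weighted_dilation \<zeta>\<close>. For \<open>\<bar>\<zeta>\<bar> = 1\<close> the dilation is
  unitary.
\<close>
definition weighted_dilation :: "complex \<Rightarrow> complex^2 \<Rightarrow> complex^2" where
  "weighted_dilation \<zeta> z = vector [\<zeta>\<^sup>2 * z $ 1, \<zeta> * z $ 2]"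

lemma weighted_dilation_nth [simp]:
  "weighted_dilation \<zeta> z $ 1 = \<zeta>\<^sup>2 * z $ 1" "weighted_dilation \<zeta> z $ 2 = \<zeta> * z $ 2"
  by (simp_all add: weighted_dilation_def)

lemma weighted_dilation_0: "weighted_dilation 0 z = 0"
  by (simp add: vec_eq_iff forall_2)

lemma norm_weighted_dilation_le: "norm \<zeta> \<le> 1 \<Longrightarrow> norm (weighted_dilation \<zeta> z) \<le> norm z"
  unfolding norm_vec2
  by (intro real_sqrt_le_mono add_mono power_mono)
    (auto simp: norm_mult norm_power intro!: mult_left_le_one_le power_le_one)

lemma weighted_dilation_has_derivative:
  "((\<lambda>\<zeta>. weighted_dilation \<zeta> z) has_derivative (\<lambda>h. h *s vector [2 * \<zeta> * z $ 1, z $ 2])) (at \<zeta>)"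
proof -
  have d: "((\<lambda>\<zeta>. \<zeta>\<^sup>2 * z $ 1) has_derivative (\<lambda>h. h * (2 * \<zeta> * z $ 1))) (at \<zeta>)"
    "((\<lambda>\<zeta>. \<zeta> * z $ 2) has_derivative (\<lambda>h. h * z $ 2)) (at \<zeta>)"
    by (auto intro!: derivative_eq_intros simp: fun_eq_iff)
  have "((\<lambda>\<zeta>. axis 1 (\<zeta>\<^sup>2 * z $ 1) + axis 2 (\<zeta> * z $ 2) :: complex^2) has_derivative
     (\<lambda>h. axis 1 (h * (2 * \<zeta> * z $ 1)) + axis 2 (h * z $ 2))) (at \<zeta>)"
    by (intro has_derivative_add bounded_linear.has_derivative[OF bounded_linear_axis] d)
  moreover have "(\<lambda>\<zeta>. axis 1 (\<zeta>\<^sup>2 * z $ 1) + axis 2 (\<zeta> * z $ 2) :: complex^2) = (\<lambda>\<zeta>. weighted_dilation \<zeta> z)"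
    by (auto simp: fun_eq_iff vec_eq_iff forall_2 axis_def)
  moreover have "(\<lambda>h. axis 1 (h * (2 * \<zeta> * z $ 1)) + axis 2 (h * z $ 2) :: complex^2) = (\<lambda>h. h *s vector [2 * \<zeta> * z $ 1, z $ 2])"
    by (auto simp: fun_eq_iff vec_eq_iff forall_2 axis_def)
  ultimately show ?thesis by (simp only:)
qed

definition shear_coeff :: "(complex^2 \<Rightarrow> complex^2) \<Rightarrow> complex" where
  "shear_coeff h = 1/2 * partial_deriv 2 (partial_deriv 2 (\<lambda>w. h w $ 1)) 0"

lemma mat_mult_vec_nth: "(mat c *v (v :: 'a::comm_semiring_1^'n)) $ i = c * v $ i"
proof -
  have "(mat c *v v) $ i = (\<Sum>j\<in>UNIV. if j = i then c * v $ j else 0)"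
    unfolding matrix_vector_mult_def mat_def vec_lambda_beta by (rule sum.cong) auto
  then show ?thesis by simp
qed

lemma scaleR_eq_matrix: "(\<lambda>v. a *\<^sub>R v) = (\<lambda>v. mat (of_real a) *v (v :: complex^'n))"
  by (auto simp: fun_eq_iff vec_eq_iff mat_mult_vec_nth scaleR_conv_of_real[where 'a=complex])

lemma partial_deriv_scaling:
  fixes f :: "complex^'n \<Rightarrow> complex^'n"
  assumes "(f has_derivative (\<lambda>v. a *\<^sub>R v)) (at w)"
  shows "partial_deriv j (\<lambda>w. f w $ i) w = (if i = j then of_real a else 0)"
  using partial_deriv_eq[OF assms[unfolded scaleR_eq_matrix]] by (simp add: mat_def)

lemma shearing_eq:
  assumes "(h has_derivative (\<lambda>v. a *\<^sub>R v)) (at 0)"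
  shows "shearing h z = vector [of_real a * z $ 1 + shear_coeff h * (z $ 2)\<^sup>2, of_real a * z $ 2]"
  by (simp add: shearing_def shear_coeff_def Let_def partial_deriv_scaling[OF assms])

lemma cnj_pairing_le:
  "norm (x1 * cnj (w $ 1) + x2 * cnj (w $ 2)) \<le> norm (vector [x1, x2] :: complex^2) * norm (w :: complex^2)"
proof -
  have "norm (x1 * cnj (w $ 1) + x2 * cnj (w $ 2)) \<le> norm x1 * norm (w$1) + norm x2 * norm (w$2)"
    using norm_triangle_ineq[of "x1 * cnj (w $ 1)" "x2 * cnj (w $ 2)"] by (simp add: norm_mult)
  also have "\<dots> \<le> norm (vector [x1, x2] :: complex^2) * norm w"
    using L2_set_mult_ineq[of "\<lambda>i. norm ((vector [x1, x2] :: complex^2) $ i)" "\<lambda>i. norm (w $ i)" UNIV]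
    by (simp add: norm_vec_def sum_2)
  finally show ?thesis .
qed

text \<open>
  This is the inclusion property of the sheared chain. Let \<open>c \<zeta>\<close> be the point of the ball that
  \<open>g\<close> sends to \<open>f\<close> of the dilated point \<open>weighted_dilation \<zeta> z\<close>. Undoing the dilation on \<open>c \<zeta>\<close> gives
  \<open>(c\<^sub>1/\<zeta>\<^sup>2, c\<^sub>2/\<zeta>)\<close>, which tends to the preimage \<open>w\<close> of \<open>shearing f z\<close> under \<open>shearing g\<close>. Its
  pairing \<open>\<psi>\<close> with \<open>w\<close> has value \<open>(norm w)\<^sup>2\<close> at 0 and is bounded on the unit circle by a number
  below \<open>norm w\<close>, so the maximum principle forces \<open>norm w < 1\<close>. The curve \<open>c\<close> is known to be
  holomorphic only where the Jacobian determinant \<open>J\<close> of \<open>g\<close> along \<open>c\<close> does not vanish.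
\<close>
lemma shearing_image_mono:
  assumes hf: "holomorphic_map_on f (ball 0 1)" and f0: "f 0 = 0"
    and df: "(f has_derivative (\<lambda>v. a *\<^sub>R v)) (at 0)"
    and g: "univalent_on g (ball 0 1)" and g0: "g 0 = 0"
    and dg: "(g has_derivative (\<lambda>v. b *\<^sub>R v)) (at 0)" and "b \<noteq> 0"
    and sub: "f ` ball 0 1 \<subseteq> g ` ball 0 1"
  shows "shearing f ` ball 0 1 \<subseteq> shearing g ` ball 0 1"
proof (rule image_subsetI)
  fix z :: "complex^2" assume z: "z \<in> ball 0 1"
  have hg: "holomorphic_map_on g (ball 0 1)" and ig: "inj_on g (ball 0 1)"
    using g by (auto simp: univalent_on_def)
  let ?R = "\<lambda>\<zeta>. weighted_dilation \<zeta> z"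
  define c where "c = (\<lambda>\<zeta>. inv_into (ball 0 1) g (f (?R \<zeta>)))"
  define J where "J = (\<lambda>\<zeta>. det (jacobian g (c \<zeta>)))"
  define D where "D = {\<zeta>\<in>ball 0 1. J \<zeta> \<noteq> 0}"
  define X where "X = of_real a * z $ 1 + shear_coeff f * (z $ 2)\<^sup>2"
  define w2 where "w2 = of_real a / of_real b * z $ 2"
  define w1 where "w1 = (X - shear_coeff g * w2\<^sup>2) / of_real b"
  define w :: "complex^2" where "w = vector [w1, w2]"
  have R: "?R \<zeta> \<in> ball 0 1" if "norm \<zeta> \<le> 1" for \<zeta>
    using norm_weighted_dilation_le[OF that, of z] z by auto
  have gc: "g (c \<zeta>) = f (?R \<zeta>)" and cB: "c \<zeta> \<in> ball 0 1" if "norm \<zeta> \<le> 1" for \<zeta>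
  proof -
    have "f (?R \<zeta>) \<in> g ` ball 0 1" using R[OF that] sub by blast
    then show "g (c \<zeta>) = f (?R \<zeta>)" "c \<zeta> \<in> ball 0 1"
      unfolding c_def by (rule f_inv_into_f, rule inv_into_into)
  qed
  have c0: "c 0 = 0"
    using inv_into_f_f[OF ig, of 0] by (simp add: c_def weighted_dilation_0 f0 g0)
  have cont_R: "continuous_on (cball 0 1) ?R"
    by (intro continuous_at_imp_continuous_on ballI)
      (rule has_derivative_continuous[OF weighted_dilation_has_derivative])
  have "continuous_on (cball 0 1) (\<lambda>\<zeta>. f (?R \<zeta>))"
    by (rule continuous_on_compose2[OF holomorphic_map_on_continuous[OF hf] cont_R]) (use R in auto)
  then have cont_c: "continuous_on (cball 0 1) c"
    unfolding c_def
    by (rule continuous_on_compose2[OF univalent_inverse_continuous[OF g open_ball]]) (use R sub in auto)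
  have cont_J: "continuous_on (cball 0 1) J"
    unfolding J_def
    by (rule continuous_on_compose2[OF det_jacobian_continuous[OF hg open_ball] cont_c]) (use cB in auto)
  have "jacobian g 0 = mat (of_real b)"
    using dg unfolding scaleR_eq_matrix by (rule jacobian_eq)
  then have J0: "J 0 \<noteq> 0"
    using \<open>b \<noteq> 0\<close> by (simp add: J_def c0 det_2 mat_def)
  have "open (ball 0 1 \<inter> J -` (- {0}))"
    using cont_J by (intro continuous_open_preimage) (auto intro: continuous_on_subset)
  moreover have "ball 0 1 \<inter> J -` (- {0}) = D" unfolding D_def by auto
  ultimately have "open D" by simp
  have "0 \<in> D" using J0 by (simp add: D_def)
  have c_deriv: "\<exists>k. (c has_derivative (\<lambda>h. h *s k)) (at \<zeta>)" if "\<zeta> \<in> D" for \<zeta>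
  proof -
    have z1: "norm \<zeta> \<le> 1" and "det (jacobian g (c \<zeta>)) \<noteq> 0" using that by (auto simp: D_def J_def)
    then obtain M where M: "(inv_into (ball 0 1) g has_derivative (\<lambda>v. M *v v)) (at (f (?R \<zeta>)))"
      using univalent_inverse_has_derivative[OF g open_ball cB[OF z1]] unfolding gc[OF z1] by blast
    obtain L where L: "(f has_derivative (\<lambda>v. L *v v)) (at (?R \<zeta>))"
      using hf R[OF z1] unfolding holomorphic_map_on_def by blast
    show ?thesis
      unfolding c_def
      using holomorphic_map_along_curve[OF holomorphic_map_along_curve[OF weighted_dilation_has_derivative L] M]
      by blast
  qed
  have hol_c: "(\<lambda>\<zeta>. c \<zeta> $ i) holomorphic_on D" for i
    unfolding holomorphic_on_def
    using c_deriv has_derivative_component field_differentiable_at_within field_differentiable_def by blast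
  have hol_J: "J holomorphic_on D"
    unfolding J_def
    by (rule det_jacobian_along_curve[OF hg open_ball \<open>open D\<close> c_deriv]) (use cB in \<open>auto simp: D_def\<close>)
  have near0: "\<forall>\<^sub>F \<zeta> in at 0. \<zeta> \<noteq> 0 \<and> norm (\<zeta>::complex) \<le> 1"
    unfolding eventually_at by (intro exI[of _ 1]) auto

  \<comment> \<open>Both sides of \<open>g (c \<zeta>) = f (weighted_dilation \<zeta> z)\<close> are differentiated at 0.\<close>
  have c_quot: "((\<lambda>\<zeta>. c \<zeta> $ i / \<zeta>) \<longlongrightarrow> (if i = 1 then 0 else w2)) (at 0)" for i
  proof -
    obtain k where k: "(c has_derivative (\<lambda>h. h *s k)) (at 0)" using c_deriv[OF \<open>0 \<in> D\<close>] by blast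
    have "(g has_derivative (\<lambda>v. mat (of_real b) *v v)) (at (c 0))"
      using dg unfolding scaleR_eq_matrix c0 .
    from has_derivative_component[OF holomorphic_map_along_curve[OF k this], of i]
    have "((\<lambda>\<zeta>. g (c \<zeta>) $ i) has_field_derivative of_real b * k $ i) (at 0)"
      unfolding mat_mult_vec_nth .
    then have 1: "((\<lambda>\<zeta>. f (?R \<zeta>) $ i) has_field_derivative of_real b * k $ i) (at 0)"
      by (rule has_field_derivative_transform_within[OF _ zero_less_one]) (use gc in auto)
    have "(f has_derivative (\<lambda>v. mat (of_real a) *v v)) (at (?R 0))"
      using df unfolding scaleR_eq_matrix weighted_dilation_0 .
    from has_derivative_component[OF holomorphic_map_along_curve[OF weighted_dilation_has_derivative this], of i]
    have 2: "((\<lambda>\<zeta>. f (?R \<zeta>) $ i) has_field_derivative of_real a * (vector [0, z $ 2] :: complex^2) $ i) (at 0)"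
      by (simp add: mat_mult_vec_nth)
    have "of_real b * k $ i = of_real a * (vector [0, z $ 2] :: complex^2) $ i"
      by (rule DERIV_unique[OF 1 2])
    then have "k $ i = of_real a * (vector [0, z $ 2] :: complex^2) $ i / of_real b"
      using \<open>b \<noteq> 0\<close> by (simp add: field_simps)
    also have "\<dots> = (if i = 1 then 0 else w2)"
      using exhaust_2[of i] by (auto simp: w2_def)
    finally have "k $ i = (if i = 1 then 0 else w2)" .
    with has_derivative_component[OF k, of i] show ?thesis
      unfolding has_field_derivative_iff by (simp add: c0)
  qed
  have quot2: "((\<lambda>\<zeta>. c \<zeta> $ 2 / \<zeta>) \<longlongrightarrow> w2) (at 0)" using c_quot[of 2] by simp

  have lim_c: "(c \<longlongrightarrow> 0) (at 0)"
    using c_deriv[OF \<open>0 \<in> D\<close>] has_derivative_continuous c0 by (metis continuous_within)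
  have lim_R: "(?R \<longlongrightarrow> 0) (at 0)"
    using has_derivative_continuous[OF weighted_dilation_has_derivative[of z 0]]
    by (simp add: continuous_within weighted_dilation_0)
  obtain qf Bf where qf: "(qf \<longlongrightarrow> of_real a) (nhds 0)" and Bf: "(Bf \<longlongrightarrow> shear_coeff f) (nhds 0)"
    and ef: "\<And>p. p \<in> ball 0 1 \<Longrightarrow> f p $ 1 = qf p * p $ 1 + Bf (p $ 2) * (p $ 2)\<^sup>2"
    using shear_expansion[OF hf, of 1] f0
    unfolding partial_deriv_scaling[OF df] shear_coeff_def by auto
  obtain qg Bg where qg: "(qg \<longlongrightarrow> of_real b) (nhds 0)" and Bg: "(Bg \<longlongrightarrow> shear_coeff g) (nhds 0)"
    and eg: "\<And>p. p \<in> ball 0 1 \<Longrightarrow> g p $ 1 = qg p * p $ 1 + Bg (p $ 2) * (p $ 2)\<^sup>2"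
    using shear_expansion[OF hg, of 1] g0
    unfolding partial_deriv_scaling[OF dg] shear_coeff_def by auto
  \<comment> \<open>The weight 2 parts of the same identity give the limit of \<open>c \<zeta> $ 1 / \<zeta>\<^sup>2\<close>: the left-hand side
    is affine in this quotient, with slope tending to \<open>b \<noteq> 0\<close>, so it need not be bounded in advance.\<close>
  have lim_fR: "((\<lambda>\<zeta>. f (?R \<zeta>) $ 1 / \<zeta>\<^sup>2) \<longlongrightarrow> X) (at 0)"
  proof (rule Lim_transform_eventually)
    have "((\<lambda>\<zeta>. ?R \<zeta> $ 2) \<longlongrightarrow> 0) (at 0)" using tendsto_vec_nth[OF lim_R, of 2] by simp
    then have "((\<lambda>\<zeta>. Bf (?R \<zeta> $ 2)) \<longlongrightarrow> shear_coeff f) (at 0)"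
      by (rule filterlim_compose[OF Bf])
    moreover have "((\<lambda>\<zeta>. qf (?R \<zeta>)) \<longlongrightarrow> of_real a) (at 0)"
      by (rule filterlim_compose[OF qf lim_R])
    ultimately show "((\<lambda>\<zeta>. qf (?R \<zeta>) * z $ 1 + Bf (?R \<zeta> $ 2) * (z $ 2)\<^sup>2) \<longlongrightarrow> X) (at 0)"
      unfolding X_def by (intro tendsto_intros)
    show "\<forall>\<^sub>F \<zeta> in at 0. qf (?R \<zeta>) * z $ 1 + Bf (?R \<zeta> $ 2) * (z $ 2)\<^sup>2 = f (?R \<zeta>) $ 1 / \<zeta>\<^sup>2"
      using near0 by eventually_elim (use ef R in \<open>simp add: field_simps\<close>)
  qed
  have quot1: "((\<lambda>\<zeta>. c \<zeta> $ 1 / \<zeta>\<^sup>2) \<longlongrightarrow> w1) (at 0)"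
  proof (rule Lim_transform_eventually)
    have "((\<lambda>\<zeta>. c \<zeta> $ 2) \<longlongrightarrow> 0) (at 0)" using tendsto_vec_nth[OF lim_c, of 2] by simp
    then have "((\<lambda>\<zeta>. Bg (c \<zeta> $ 2)) \<longlongrightarrow> shear_coeff g) (at 0)"
      by (rule filterlim_compose[OF Bg])
    moreover have qgc: "((\<lambda>\<zeta>. qg (c \<zeta>)) \<longlongrightarrow> of_real b) (at 0)"
      by (rule filterlim_compose[OF qg lim_c])
    ultimately show "((\<lambda>\<zeta>. (f (?R \<zeta>) $ 1 / \<zeta>\<^sup>2 - Bg (c \<zeta> $ 2) * (c \<zeta> $ 2 / \<zeta>)\<^sup>2) / qg (c \<zeta>)) \<longlongrightarrow> w1) (at 0)"
      unfolding w1_def using \<open>b \<noteq> 0\<close> by (intro tendsto_intros lim_fR quot2) auto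
    have "\<forall>\<^sub>F \<zeta> in at 0. qg (c \<zeta>) \<noteq> 0"
      using tendsto_imp_eventually_ne[OF qgc, of 0] \<open>b \<noteq> 0\<close> by simp
    with near0 show "\<forall>\<^sub>F \<zeta> in at 0. (f (?R \<zeta>) $ 1 / \<zeta>\<^sup>2 - Bg (c \<zeta> $ 2) * (c \<zeta> $ 2 / \<zeta>)\<^sup>2) / qg (c \<zeta>) = c \<zeta> $ 1 / \<zeta>\<^sup>2"
    proof eventually_elim
      case (elim \<zeta>)
      then have "f (?R \<zeta>) $ 1 = qg (c \<zeta>) * c \<zeta> $ 1 + Bg (c \<zeta> $ 2) * (c \<zeta> $ 2)\<^sup>2"
        using gc[of \<zeta>] eg[OF cB[of \<zeta>]] by simp
      then show ?case using elim by (simp add: field_simps power_divide)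
    qed
  qed

  \<comment> \<open>Pairing with the limit \<open>w\<close> itself makes the value at 0 equal to \<open>(norm w)\<^sup>2\<close>.\<close>
  define F where "F = (\<lambda>\<zeta>. c \<zeta> $ 1 / \<zeta>\<^sup>2 * cnj (w $ 1) + c \<zeta> $ 2 / \<zeta> * cnj (w $ 2))"
  define \<psi> where "\<psi> = (\<lambda>\<zeta>. if \<zeta> = 0 then w $ 1 * cnj (w $ 1) + w $ 2 * cnj (w $ 2) else F \<zeta>)"
  have lim_psi: "(\<psi> \<longlongrightarrow> \<psi> 0) (at 0)"
  proof (rule Lim_transform_eventually)
    have "(F \<longlongrightarrow> w1 * cnj (w $ 1) + w2 * cnj (w $ 2)) (at 0)"
      unfolding F_def by (intro tendsto_add tendsto_mult tendsto_const quot1 quot2)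
    then show "(F \<longlongrightarrow> \<psi> 0) (at 0)" by (simp add: \<psi>_def w_def)
    show "\<forall>\<^sub>F \<zeta> in at 0. F \<zeta> = \<psi> \<zeta>"
      using near0 by eventually_elim (simp add: \<psi>_def)
  qed
  have cont_psi: "continuous_on (cball 0 1) \<psi>"
  proof (unfold continuous_on_def, rule ballI)
    fix x :: complex assume x: "x \<in> cball 0 1"
    show "(\<psi> \<longlongrightarrow> \<psi> x) (at x within cball 0 1)"
    proof (cases "x = 0")
      case True
      then show ?thesis using lim_psi by (auto intro: tendsto_within_subset[where S = UNIV])
    next
      case False
      have "(c \<longlongrightarrow> c x) (at x within cball 0 1)" using cont_c x by (simp add: continuous_on_def)
      then have "(F \<longlongrightarrow> F x) (at x within cball 0 1)"
        unfolding F_def using False by (intro tendsto_intros) auto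
      then have "(F \<longlongrightarrow> \<psi> x) (at x within cball 0 1)" using False by (simp add: \<psi>_def)
      moreover have "\<forall>\<^sub>F \<zeta> in at x within cball 0 1. \<zeta> \<noteq> 0"
        using False by (metis eventually_neq_at_within)
      then have "\<forall>\<^sub>F \<zeta> in at x within cball 0 1. F \<zeta> = \<psi> \<zeta>"
        by eventually_elim (simp add: \<psi>_def)
      ultimately show ?thesis by (rule Lim_transform_eventually)
    qed
  qed
  have hol_psi: "\<psi> holomorphic_on D"
  proof (rule no_isolated_singularity[where K = "{0}"])
    show "continuous_on D \<psi>" using cont_psi by (rule continuous_on_subset) (auto simp: D_def)
    have "F holomorphic_on D - {0}"
      unfolding F_def by (intro holomorphic_intros holomorphic_on_subset[OF hol_c]) auto
    then show "\<psi> holomorphic_on D - {0}"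
      by (rule holomorphic_transform) (simp add: \<psi>_def)
  qed (use \<open>open D\<close> in auto)

  \<comment> \<open>Compactness of the circle leaves room below 1, which makes the final inequality strict.\<close>
  have "continuous_on (sphere 0 1) (\<lambda>\<zeta>. norm (c \<zeta>))"
    by (intro continuous_intros continuous_on_subset[OF cont_c]) auto
  then obtain \<zeta>1 where \<zeta>1: "\<zeta>1 \<in> sphere 0 1" 
    and max: "\<And>\<zeta>. \<zeta> \<in> sphere (0::complex) 1 \<Longrightarrow> norm (c \<zeta>) \<le> norm (c \<zeta>1)"
    using continuous_attains_sup[OF compact_sphere[of "0::complex" 1]] by force
  have "norm (\<psi> 0) \<le> norm (c \<zeta>1) * norm w"
  proof (rule maximum_modulus_off_zeros[OF cont_psi cont_J _ _ J0])
    fix \<zeta> :: complex assume u: "norm \<zeta> = 1"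
    then have "\<psi> \<zeta> = F \<zeta>" by (auto simp: \<psi>_def)
    then have "norm (\<psi> \<zeta>) \<le> norm (vector [c \<zeta> $ 1 / \<zeta>\<^sup>2, c \<zeta> $ 2 / \<zeta>] :: complex^2) * norm w"
      using cnj_pairing_le[of "c \<zeta> $ 1 / \<zeta>\<^sup>2" w "c \<zeta> $ 2 / \<zeta>"] by (simp only: F_def)
    also have "norm (vector [c \<zeta> $ 1 / \<zeta>\<^sup>2, c \<zeta> $ 2 / \<zeta>] :: complex^2) = norm (c \<zeta>)"
      using u by (simp add: norm_vec2 norm_divide norm_power)
    also have "\<dots> * norm w \<le> norm (c \<zeta>1) * norm w"
      using max[of \<zeta>] u by (intro mult_right_mono) auto
    finally show "norm (\<psi> \<zeta>) \<le> norm (c \<zeta>1) * norm w" .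
  qed (use hol_psi hol_J in \<open>simp_all add: D_def\<close>)
  moreover have "\<psi> 0 = of_real ((norm w)\<^sup>2)"
  proof -
    have "(norm w)\<^sup>2 = (norm (w$1))\<^sup>2 + (norm (w$2))\<^sup>2" by (simp add: norm_vec2)
    then show ?thesis by (simp add: \<psi>_def complex_norm_square[symmetric])
  qed
  ultimately have "norm w * norm w \<le> norm (c \<zeta>1) * norm w"
    by (simp add: norm_power power2_eq_square norm_mult)
  moreover have "norm (c \<zeta>1) < 1" using cB[of \<zeta>1] \<zeta>1 by simp
  ultimately have "norm w < 1"
    by (cases "w = 0") auto
  moreover have "shearing g w = shearing f z"
    unfolding shearing_eq[OF df] shearing_eq[OF dg] using \<open>b \<noteq> 0\<close>
    by (simp add: vec_eq_iff forall_2 w_def w1_def w2_def X_def)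
  ultimately show "shearing f z \<in> shearing g ` ball 0 1"
    by (metis image_eqI mem_ball_0)
qed

section \<open>The sheared chain\<close>

lemma shearing_has_derivative:
  assumes "(h has_derivative (\<lambda>v. a *\<^sub>R v)) (at 0)"
  shows "(shearing h has_derivative
    (\<lambda>v. (vector [vector [of_real a, 2 * shear_coeff h * z $ 2], vector [0, of_real a]] :: complex^2^2) *v v)) (at z)"
proof -
  let ?A = "shear_coeff h"
  have d: "((\<lambda>z::complex^2. z $ i) has_derivative (\<lambda>v. v $ i)) (at z)" for i
    by (rule bounded_linear_imp_has_derivative[OF bounded_linear_vec_nth])
  have 1: "((\<lambda>z::complex^2. of_real a * z $ 1 + ?A * (z $ 2)\<^sup>2) has_derivative
          (\<lambda>v. of_real a * v $ 1 + 2 * ?A * z $ 2 * v $ 2)) (at z)"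
    by (auto intro!: derivative_eq_intros d simp: fun_eq_iff)
  have 2: "((\<lambda>z::complex^2. of_real a * z $ 2) has_derivative (\<lambda>v. of_real a * v $ 2)) (at z)"
    by (auto intro!: derivative_eq_intros d)
  have "((\<lambda>z::complex^2. axis 1 (of_real a * z $ 1 + ?A * (z $ 2)\<^sup>2) + axis 2 (of_real a * z $ 2) :: complex^2)
      has_derivative (\<lambda>v. axis 1 (of_real a * v $ 1 + 2 * ?A * z $ 2 * v $ 2) + axis 2 (of_real a * v $ 2))) (at z)"
    by (intro has_derivative_add bounded_linear.has_derivative[OF bounded_linear_axis] 1 2)
  moreover have "(\<lambda>z::complex^2. axis 1 (of_real a * z $ 1 + ?A * (z $ 2)\<^sup>2) + axis 2 (of_real a * z $ 2) :: complex^2) = shearing h"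
    by (auto simp: fun_eq_iff vec_eq_iff forall_2 axis_def shearing_eq[OF assms])
  moreover have "(\<lambda>v. axis 1 (of_real a * v $ 1 + 2 * ?A * z $ 2 * v $ 2) + axis 2 (of_real a * v $ 2)) =
    (\<lambda>v. (vector [vector [of_real a, 2 * ?A * z $ 2], vector [0, of_real a]] :: complex^2^2) *v v)"
    by (auto simp: fun_eq_iff vec_eq_iff forall_2 axis_def matrix_vector_mult_def sum_2)
  ultimately show ?thesis by (simp only:)
qed

lemma shearing_has_derivative_0:
  assumes "(h has_derivative (\<lambda>v. a *\<^sub>R v)) (at 0)"
  shows "(shearing h has_derivative (\<lambda>v. a *\<^sub>R v)) (at 0)"
proof -
  have "(\<lambda>v. (vector [vector [of_real a, 2 * shear_coeff h * (0::complex^2) $ 2], vector [0, of_real a]] :: complex^2^2) *v v)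
    = (\<lambda>v. a *\<^sub>R v)"
    by (simp add: fun_eq_iff vec_eq_iff forall_2 matrix_vector_mult_def sum_2 scaleR_conv_of_real[where 'a=complex])
  with shearing_has_derivative[OF assms, of 0] show ?thesis by (simp only:)
qed

lemma shearing_univalent:
  assumes dh: "(h has_derivative (\<lambda>v. a *\<^sub>R v)) (at 0)" and "a \<noteq> 0"
  shows "univalent_on (shearing h) S"
  unfolding univalent_on_def
proof
  show "holomorphic_map_on (shearing h) S"
    unfolding holomorphic_map_on_def using shearing_has_derivative[OF dh] by blast
  show "inj_on (shearing h) S"
    unfolding inj_on_def shearing_eq[OF dh] using \<open>a \<noteq> 0\<close> by (auto simp: vec_eq_iff forall_2)
qed

text \<open>
  A sequence of members with norms at least \<open>n\<close> at points of \<open>K\<close> has no subsequence converging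
  uniformly on \<open>K\<close>, because the limit would be continuous and hence bounded there.
\<close>
lemma normal_family_bounded_on_compact:
  assumes "normal_family_on F S" "compact K" "K \<subseteq> S"
    and cont: "\<And>f. f \<in> F \<Longrightarrow> continuous_on K f"
  shows "\<exists>M. \<forall>f\<in>F. \<forall>z\<in>K. norm (f z) \<le> M"
proof (rule ccontr)
  assume "\<nexists>M. \<forall>f\<in>F. \<forall>z\<in>K. norm (f z) \<le> M"
  then have "\<forall>n::nat. \<exists>f z. f \<in> F \<and> z \<in> K \<and> \<not> norm (f z) \<le> real n"
    by blast
  then obtain \<phi> x where \<phi>: "\<And>n. \<phi> n \<in> F" and x: "\<And>n. x n \<in> K" and big: "\<And>n. \<not> norm (\<phi> n (x n)) \<le> real n"
    by metis
  obtain r g where r: "strict_mono (r::nat \<Rightarrow> nat)" and "uniform_limit K (\<phi> \<circ> r) g sequentially"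
    using assms(1-3) \<phi> unfolding normal_family_on_def by metis
  then have lim: "uniform_limit K (\<phi> \<circ> r) g sequentially" by simp
  have "continuous_on K g"
    by (rule uniform_limit_theorem[OF _ lim]) (use cont \<phi> in auto)
  then have "bounded (g ` K)"
    using \<open>compact K\<close> by (intro compact_imp_bounded compact_continuous_image)
  then obtain M where M: "\<And>z. z \<in> K \<Longrightarrow> norm (g z) \<le> M"
    unfolding bounded_iff by blast
  obtain N where N: "\<And>n. n \<ge> N \<Longrightarrow> \<forall>z\<in>K. dist ((\<phi> \<circ> r) n z) (g z) < 1"
    using uniform_limitD[OF lim zero_less_one] unfolding eventually_sequentially by blast
  obtain m :: nat where m: "M + 1 \<le> real m" using real_arch_simple by blast
  define n where "n = max N m"
  have "norm (\<phi> (r n) (x (r n))) \<le> norm (g (x (r n))) + 1"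
    using N[of n] x[of "r n"] norm_triangle_sub[of "\<phi> (r n) (x (r n))" "g (x (r n))"]
    by (fastforce simp: n_def dist_norm)
  also have "\<dots> \<le> real m" using M[OF x[of "r n"]] m by linarith
  also have "\<dots> \<le> real (r n)" using strict_mono_imp_increasing[OF r, of n] by (simp add: n_def)
  finally show False using big[of "r n"] by blast
qed

lemma shear_coeff_bound:
  assumes hol: "holomorphic_map_on h (ball 0 1)"
    and M: "\<And>z. z \<in> cball 0 (1/2) \<Longrightarrow> norm (h z) \<le> M"
  shows "norm (shear_coeff h) \<le> 4 * M"
proof -
  define k where "k = (\<lambda>v. h (0 + axis 2 v) $ 1)"
  have k: "k holomorphic_on ball 0 1"
    unfolding k_def by (rule slice_holomorphic[OF hol]) (auto simp: norm_axis)
  have "norm ((deriv ^^ 2) k 0) \<le> fact 2 * M / (1/2)^2"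
  proof (rule Cauchy_inequality)
    show "k holomorphic_on ball 0 (1/2)" by (rule holomorphic_on_subset[OF k]) auto
    show "continuous_on (cball 0 (1/2)) k"
      by (rule continuous_on_subset[OF holomorphic_on_imp_continuous_on[OF k]]) auto
    show "norm (k x) \<le> M" if "norm (0 - x) = 1/2" for x
    proof -
      have "norm (h (0 + axis 2 x)) \<le> M" by (rule M) (use that in \<open>simp add: norm_axis\<close>)
      then show ?thesis
        unfolding k_def using Finite_Cartesian_Product.norm_nth_le[of "h (0 + axis 2 x)" 1] by linarith
    qed
  qed simp
  moreover have "deriv k = (\<lambda>v. partial_deriv 2 (\<lambda>w. h w $ 1) (0 + axis 2 v))"
    unfolding k_def by (rule ext, rule deriv_slice)
  then have "(deriv ^^ 2) k 0 = 2 * shear_coeff h"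
    by (simp add: shear_coeff_def partial_deriv_def[of 2 "partial_deriv 2 _"] eval_nat_numeral)
  ultimately show ?thesis by (simp add: norm_mult power2_eq_square fact_numeral eval_nat_numeral)
qed

lemma partial_deriv_cong:
  assumes "open S" "a \<in> S" "\<And>w. w \<in> S \<Longrightarrow> f w = g w"
  shows "partial_deriv j f a = partial_deriv j g a"
  unfolding partial_deriv_def
proof (rule deriv_cong_ev)
  have "isCont (\<lambda>\<zeta>. a + axis j \<zeta>) 0"
    by (rule has_derivative_continuous[OF has_derivative_axis_line])
  then have "((\<lambda>\<zeta>. a + axis j \<zeta>) \<longlongrightarrow> a) (nhds 0)"
    by (simp add: isCont_def tendsto_nhds_iff axis_zero)
  then have "\<forall>\<^sub>F \<zeta> in nhds 0. a + axis j \<zeta> \<in> S"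
    using assms(1,2) by (rule topological_tendstoD)
  then show "\<forall>\<^sub>F \<zeta> in nhds 0. f (a + axis j \<zeta>) = g (a + axis j \<zeta>)"
    by eventually_elim (rule assms(3))
qed simp

text \<open>
  A chain witnessing membership in \<open>S0\<close> starts at \<open>f\<close> on the unit ball only; shearings do not see
  the values outside.
\<close>
lemma shearing_cong:
  assumes "\<And>z. z \<in> ball 0 1 \<Longrightarrow> h z = k z"
  shows "shearing h = shearing k"
proof -
  have p: "partial_deriv j (\<lambda>w. h w $ i) a = partial_deriv j (\<lambda>w. k w $ i) a" if "a \<in> ball 0 1" for i j a
    by (rule partial_deriv_cong[OF open_ball that]) (simp only: assms)
  have "(0::complex^2) \<in> ball 0 1" by simp
  note partial_deriv_cong[OF open_ball this p] p[OF this]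
  then show ?thesis unfolding shearing_def by (simp only:)
qed

text \<open>
  The rescaled shearings differ only in the coefficient of \<open>(z$2)\<^sup>2\<close>, so Bolzano-Weierstrass for
  this coefficient is enough.
\<close>
lemma shearings_normal:
  fixes f :: "real \<Rightarrow> complex^2 \<Rightarrow> complex^2"
  assumes df: "\<And>t. t \<ge> 0 \<Longrightarrow> (f t has_derivative (\<lambda>v. exp t *\<^sub>R v)) (at 0)"
    and C: "\<And>t. t \<ge> 0 \<Longrightarrow> norm (exp (-t) *\<^sub>R shear_coeff (f t)) \<le> C"
  shows "normal_family_on {\<lambda>z. exp (- t) *\<^sub>R shearing (f t) z |t. t \<ge> 0} (ball 0 1)"
  unfolding normal_family_on_def
proof (intro allI impI)
  fix \<phi> :: "nat \<Rightarrow> complex^2 \<Rightarrow> complex^2"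
  assume "\<forall>k. \<phi> k \<in> {\<lambda>z. exp (- t) *\<^sub>R shearing (f t) z |t. t \<ge> 0}"
  then obtain t where t: "\<And>k. t k \<ge> 0" and \<phi>: "\<And>k. \<phi> k = (\<lambda>z. exp (- t k) *\<^sub>R shearing (f (t k)) z)"
    by (simp only: mem_Collect_eq) metis
  define a where "a = (\<lambda>k. exp (- t k) *\<^sub>R shear_coeff (f (t k)))"
  have \<phi>': "\<phi> k z = vector [z $ 1 + a k * (z $ 2)\<^sup>2, z $ 2]" for k z
  proof -
    have "exp (- t k) *\<^sub>R (complex_of_real (exp (t k)) * u) = u" for u
      by (simp add: scaleR_conv_of_real mult.assoc[symmetric] of_real_mult[symmetric] exp_minus del: of_real_mult)
    then show ?thesis
      unfolding \<phi> shearing_eq[OF df[OF t]] by (simp add: vec_eq_iff forall_2 a_def scaleR_add_right)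
  qed
  have "bounded (range a)"
    unfolding bounded_iff a_def using C t by blast
  then obtain l r where r: "strict_mono r" and l: "(a \<circ> r) \<longlonglongrightarrow> l"
    using bounded_imp_convergent_subsequence by blast
  have "uniform_limit K (\<phi> \<circ> r) (\<lambda>z. vector [z $ 1 + l * (z $ 2)\<^sup>2, z $ 2]) sequentially"
    if K: "K \<subseteq> ball 0 1" for K
  proof (rule uniform_limitI)
    fix e :: real assume "e > 0"
    show "\<forall>\<^sub>F n in sequentially. \<forall>z\<in>K. dist ((\<phi> \<circ> r) n z) (vector [z $ 1 + l * (z $ 2)\<^sup>2, z $ 2]) < e"
    proof (rule eventually_mono[OF tendstoD[OF l \<open>e > 0\<close>]], rule ballI)
      fix n z assume n: "dist ((a \<circ> r) n) l < e" and "z \<in> K"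
      have "norm (z $ 2) \<le> 1"
        using K \<open>z \<in> K\<close> Finite_Cartesian_Product.norm_nth_le[of z 2] by force
      then have "norm (z $ 2) ^ 2 \<le> 1" by (simp add: power_le_one)
      have "(\<phi> \<circ> r) n z - vector [z $ 1 + l * (z $ 2)\<^sup>2, z $ 2] = axis 1 ((a (r n) - l) * (z $ 2)\<^sup>2)"
        by (simp add: \<phi>' vec_eq_iff forall_2 axis_def algebra_simps)
      then have "dist ((\<phi> \<circ> r) n z) (vector [z $ 1 + l * (z $ 2)\<^sup>2, z $ 2]) = norm (a (r n) - l) * norm (z $ 2) ^ 2"
        by (simp add: dist_norm norm_axis norm_mult norm_power)
      also have "\<dots> \<le> norm (a (r n) - l) * 1"
        using \<open>norm (z $ 2) ^ 2 \<le> 1\<close> by (intro mult_left_mono) auto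
      also have "\<dots> < e" using n by (simp add: dist_norm)
      finally show "dist ((\<phi> \<circ> r) n z) (vector [z $ 1 + l * (z $ 2)\<^sup>2, z $ 2]) < e" .
    qed
  qed
  with r show "\<exists>r g. strict_mono r \<and> (\<forall>K. compact K \<and> K \<subseteq> ball 0 1 \<longrightarrow> uniform_limit K (\<phi> \<circ> r) g sequentially)"
    by blast
qed

text \<open>
  Normality of \<open>f\<close> bounds the rescaled maps on the ball of radius \<open>1/2\<close>, and Cauchy's inequality turns this
  into a bound for the rescaled shear coefficients.
\<close>
lemma shearing_normal_Loewner_chain:
  assumes "normal_Loewner_chain f"
  shows "normal_Loewner_chain (\<lambda>t. shearing (f t))"
proof -
  have uni: "univalent_on (f t) (ball 0 1)" and f0: "f t 0 = 0" 
    and df: "(f t has_derivative (\<lambda>v. exp t *\<^sub>R v)) (at 0)" if "t \<ge> 0" for t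
    using assms that by (auto simp: normal_Loewner_chain_def normalized_Loewner_chain_def)
  have mono: "f s ` ball 0 1 \<subseteq> f t ` ball 0 1" if "0 \<le> s" "s \<le> t" for s t
    using assms that by (auto simp: normal_Loewner_chain_def normalized_Loewner_chain_def)
  have normal: "normal_family_on {\<lambda>z. exp (- t) *\<^sub>R f t z |t. t \<ge> 0} (ball 0 1)"
    using assms by (simp add: normal_Loewner_chain_def)
  have hol: "holomorphic_map_on (f t) (ball 0 1)" if "t \<ge> 0" for t
    using uni[OF that] by (simp add: univalent_on_def)
  have cont: "continuous_on (cball 0 (1/2)) h" if "h \<in> {\<lambda>z. exp (- t) *\<^sub>R f t z |t. t \<ge> 0}" for h
    using that
    by (auto intro!: continuous_intros continuous_on_subset[OF holomorphic_map_on_continuous[OF hol]])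
  have "cball 0 (1/2) \<subseteq> ball (0::complex^2) 1" by auto
  from normal_family_bounded_on_compact[OF normal compact_cball this cont]
  obtain M where M0: "\<forall>h\<in>{\<lambda>z. exp (- t) *\<^sub>R f t z |t. t \<ge> 0}. \<forall>z\<in>cball 0 (1/2). norm (h z) \<le> M" ..
  have M: "norm (exp (- t) *\<^sub>R f t z) \<le> M" if "t \<ge> 0" "z \<in> cball 0 (1/2)" for t z
  proof -
    have "(\<lambda>z. exp (- t) *\<^sub>R f t z) \<in> {\<lambda>z. exp (- t) *\<^sub>R f t z |t. t \<ge> 0}"
      by (intro CollectI exI[of _ t] conjI refl that(1))
    from bspec[OF bspec[OF M0 this] that(2)] show ?thesis .
  qed
  have "norm (exp (-t) *\<^sub>R shear_coeff (f t)) \<le> 4 * M" if t: "t \<ge> 0" for t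
  proof -
    have "norm (shear_coeff (f t)) \<le> 4 * (exp t * M)"
      by (rule shear_coeff_bound[OF hol[OF t]]) (use M[OF t] in \<open>simp add: exp_minus field_simps\<close>)
    then show ?thesis by (simp add: exp_minus field_simps)
  qed
  then have "normal_family_on {\<lambda>z. exp (- t) *\<^sub>R shearing (f t) z |t. t \<ge> 0} (ball 0 1)"
    by (intro shearings_normal[where f = f]) (auto intro: df)
  moreover have "shearing (f s) ` ball 0 1 \<subseteq> shearing (f t) ` ball 0 1" if "0 \<le> s" "s \<le> t" for s t
    using that by (intro shearing_image_mono[OF hol f0 df uni f0 df _ mono]) auto
  moreover have "univalent_on (shearing (f t)) (ball 0 1)" if "t \<ge> 0" for t
    by (rule shearing_univalent[OF df[OF that]]) simp
  moreover have "shearing (f t) 0 = 0" if "t \<ge> 0" for t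
    unfolding shearing_eq[OF df[OF that]] by (simp add: vec_eq_iff forall_2)
  ultimately show ?thesis
    unfolding normal_Loewner_chain_def normalized_Loewner_chain_def
    using shearing_has_derivative_0[OF df] by blast
qed

theorem theorem1p4:
  "(\<forall>f. normal_Loewner_chain f \<longrightarrow> normal_Loewner_chain (\<lambda>t. shearing (f t))) \<and>
   (\<forall>f\<in>S0. shearing f \<in> S0)"
proof (intro conjI allI impI ballI)
  fix f assume "f \<in> S0"
  then obtain F where F: "normal_Loewner_chain F" and F0: "\<And>z. z \<in> ball 0 1 \<Longrightarrow> F 0 z = f z"
    and df: "(f has_derivative (\<lambda>v. v)) (at 0)"
    unfolding S0_def by blast
  have chain: "normal_Loewner_chain (\<lambda>t. shearing (F t))"
    by (rule shearing_normal_Loewner_chain[OF F])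
  have eq: "shearing (F 0) = shearing f" by (rule shearing_cong[OF F0])
  then have "univalent_on (shearing f) (ball 0 1)" "shearing f 0 = 0"
    "(shearing f has_derivative (\<lambda>v. exp 0 *\<^sub>R v)) (at 0)"
    using chain unfolding normal_Loewner_chain_def normalized_Loewner_chain_def
    by (metis order_refl)+
  with chain eq show "shearing f \<in> S0"
    unfolding S0_def by auto
qed (rule shearing_normal_Loewner_chain)

end
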